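(* Let $(R,f,g)$ be a commutative Krasner $(m,n)$-hyperring with scalar identity $1$, let $S$ be an $n$-ary multiplicative subset of $R$, and let $I$ be a hyperideal of $R$ with $I\cap S=\varnothing$. Then $I$ is an $n$-ary $S$-primary hyperideal of $R$ if and only if there exists $s\in S$ such that $(I:s)=\{x\in R\mid g(x,s,1^{(n-2)})\in I\}$ is an $n$-ary primary hyperideal of $R$.
   Context: Notation: $x_i^j$ denotes the sequence $x_i,\dots,x_j$ (empty if $j<i$); $x^{(k)}$ denotes $x$ repeated $k$ times; operations are extended to subsets elementwise (taking unions); $m,n\ge 2$ are integers. An $m$-ary hyperoperation on $R$ is a map $f$ from $R^m$ to the nonempty subsets of $R$. $(R,f)$ is a (commutative) canonical $m$-ary hypergroup if $f$ is invariant under permuting its arguments; $f$ is associative, i.e. $f(x_1^{i-1},f(x_i^{m+i-1}),x_{m+i}^{2m-1})$ does not depend on $i$; for all $a_1^{i-1},a_{i+1}^m,b\in R$ there is $x\in R$ with $b\in f(a_1^{i-1},x,a_{i+1}^m)$; there is a unique $0\in R$ with $f(x,0^{(m-1)})=\{x\}$ for all $x$; each $x$ has a unique $-x$ with $0\in f(x,-x,0^{(m-2)})$; and $x\in f(x_1^m)$ implies $x_i\in f(x,-x_1,\dots,-x_{i-1},-x_{i+1},\dots,-x_m)$ for all $i$. A commutative Krasner $(m,n)$-hyperring $(R,f,g)$ is such an $(R,f)$ together with an associative, permutation-invariant $n$-ary operation $g:R^n\to R$ that is distributive over $f$ in each argument, i.e. $g(a_1^{i-1},f(x_1^m),a_{i+1}^n)=f(g(a_1^{i-1},x_1,a_{i+1}^n),\dots,g(a_1^{i-1},x_m,a_{i+1}^n))$,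 and satisfies $g(0,x_2^n)=0$. A scalar identity is an element $1$ with $g(x,1^{(n-1)})=x$ for all $x$. A hyperideal of $R$ is a nonempty $I\subseteq R$ such that $(I,f)$ is an $m$-ary subhypergroup of $(R,f)$ (i.e. $f(x_1^m)\subseteq I$ for $x_1^m\in I$, and $b\in f(b_1^{i-1},x,b_{i+1}^m)$ has a solution $x\in I$ whenever all $b$'s lie in $I$) and $g(x_1^{i-1},I,x_{i+1}^n)\subseteq I$ for all $x_j\in R$ and all $i$. An $n$-ary prime hyperideal is a hyperideal $P\ne R$ such that for hyperideals $U_1,\dots,U_n$ of $R$, $g(U_1^n)\subseteq P$ implies $U_i\subseteq P$ for some $i$; equivalently, for all $x_1^n\in R$, $g(x_1^n)\in P$ implies $x_i\in P$ for some $i$. The radical $\sqrt{I}^{(m,n)}$ is the intersection of all prime hyperideals containing $I$ (and is $R$ if there are none). An $n$-ary primary hyperideal is a hyperideal $I\neq R$ such that for all $x_1^n\in R$ with $g(x_1^n)\in I$ and every $1\le i\le n$: $x_i\in I$ or $g(x_1^{i-1},1,x_{i+1}^n)\in\sqrt{I}^{(m,n)}$. An $n$-ary multiplicative subset is a nonempty $S\subseteq R$ with $g(s_1^n)\in S$ for all $s_1^n\in S$. A hyperideal $I$ with $I\cap S=\varnothing$ is an $n$-ary $S$-primary hyperideal if there exists $s\in S$ such that for all $x_1^n\in R$ with $g(x_1^n)\in I$ and every $1\le i\le n$: $g(s,x_i,1^{(n-2)})\in I$ or $g(x_1^{i-1},s,x_{i+1}^n)\in\sqrt{I}^{(m,n)}$.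 *)

theory Defs
  imports "HOL-Library.Multiset" "HOL-Library.NList"
begin

text \<open>
  An argument tuple \<open>x\<^sub>1, \<dots>, x\<^sub>k\<close> over \<open>A\<close> is a list in \<open>nlists k A\<close>; positions count from 0.
  The operations \<open>f\<close> and \<open>g\<close> are total functions on lists, whose values matter only on
  \<open>nlists m R\<close> and \<open>nlists n R\<close> respectively.  The update \<open>xs[i := y]\<close> renders a tuple whose
  \<open>i\<close>-th entry is prescribed and whose other entries are those of \<open>xs\<close>.
\<close>

definition hyper_zero :: "'a set \<Rightarrow> nat \<Rightarrow> ('a list \<Rightarrow> 'a set) \<Rightarrow> 'a" where
  "hyper_zero R m f = (THE z. z \<in> R \<and> (\<forall>x\<in>R. f (x # replicate (m - 1) z) = {x}))"

definition hyper_neg :: "'a set \<Rightarrow> nat \<Rightarrow> ('a list \<Rightarrow> 'a set) \<Rightarrow> 'a \<Rightarrow> 'a" where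
  "hyper_neg R m f x =
     (THE y. y \<in> R \<and> hyper_zero R m f \<in> f (x # y # replicate (m - 2) (hyper_zero R m f)))"

locale canonical_hypergroup =
  fixes R :: "'a set" and m :: nat and f :: "'a list \<Rightarrow> 'a set"
  assumes arity_f: "2 \<le> m"
    and f_closed: "xs \<in> nlists m R \<Longrightarrow> f xs \<subseteq> R"
    and f_nonempty: "xs \<in> nlists m R \<Longrightarrow> f xs \<noteq> {}"
    and f_perm: "\<lbrakk>xs \<in> nlists m R; mset ys = mset xs\<rbrakk> \<Longrightarrow> f ys = f xs"
    and f_assoc: "\<lbrakk>xs \<in> nlists (2 * m - 1) R; i < m; j < m\<rbrakk> \<Longrightarrow>
        (\<Union>y \<in> f (take m (drop i xs)). f (take i xs @ y # drop (i + m) xs)) =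
        (\<Union>y \<in> f (take m (drop j xs)). f (take j xs @ y # drop (j + m) xs))"
    and f_solvable: "\<lbrakk>as \<in> nlists m R; i < m; b \<in> R\<rbrakk> \<Longrightarrow> \<exists>x\<in>R. b \<in> f (as[i := x])"
    and zero_ex1: "\<exists>!z. z \<in> R \<and> (\<forall>x\<in>R. f (x # replicate (m - 1) z) = {x})"
    and neg_ex1: "x \<in> R \<Longrightarrow>
        \<exists>!y. y \<in> R \<and> hyper_zero R m f \<in> f (x # y # replicate (m - 2) (hyper_zero R m f))"
    and reversible: "\<lbrakk>xs \<in> nlists m R; x \<in> f xs; i < m\<rbrakk> \<Longrightarrow>
        xs ! i \<in> f (x # map (hyper_neg R m f) (take i xs @ drop (Suc i) xs))"

text \<open>Krasner \<open>(m, n)\<close>-hyperrings are understood to be commutative.\<close>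

locale krasner_hyperring = canonical_hypergroup R m f
  for R :: "'a set" and m n :: nat and f :: "'a list \<Rightarrow> 'a set" and g :: "'a list \<Rightarrow> 'a" +
  assumes arity_g: "2 \<le> n"
    and g_closed: "xs \<in> nlists n R \<Longrightarrow> g xs \<in> R"
    and g_perm: "\<lbrakk>xs \<in> nlists n R; mset ys = mset xs\<rbrakk> \<Longrightarrow> g ys = g xs"
    and g_assoc: "\<lbrakk>xs \<in> nlists (2 * n - 1) R; i < n; j < n\<rbrakk> \<Longrightarrow>
        g (take i xs @ g (take n (drop i xs)) # drop (i + n) xs) =
        g (take j xs @ g (take n (drop j xs)) # drop (j + n) xs)"
    and g_distrib: "\<lbrakk>as \<in> nlists n R; xs \<in> nlists m R; i < n\<rbrakk> \<Longrightarrow>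
        (\<lambda>y. g (as[i := y])) ` f xs = f (map (\<lambda>x. g (as[i := x])) xs)"
    and g_zero: "xs \<in> nlists (n - 1) R \<Longrightarrow> g (hyper_zero R m f # xs) = hyper_zero R m f"

definition scalar_identity :: "'a set \<Rightarrow> nat \<Rightarrow> ('a list \<Rightarrow> 'a) \<Rightarrow> 'a \<Rightarrow> bool" where
  "scalar_identity R n g e \<longleftrightarrow> e \<in> R \<and> (\<forall>x\<in>R. g (x # replicate (n - 1) e) = x)"

definition subhypergroup :: "'a set \<Rightarrow> nat \<Rightarrow> ('a list \<Rightarrow> 'a set) \<Rightarrow> 'a set \<Rightarrow> bool" where
  "subhypergroup R m f I \<longleftrightarrow> I \<subseteq> R \<and> I \<noteq> {} \<and> (\<forall>xs\<in>nlists m I. f xs \<subseteq> I) \<and>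
     (\<forall>bs\<in>nlists m I. \<forall>i<m. \<forall>b\<in>I. \<exists>x\<in>I. b \<in> f (bs[i := x]))"

definition hyperideal ::
  "'a set \<Rightarrow> nat \<Rightarrow> nat \<Rightarrow> ('a list \<Rightarrow> 'a set) \<Rightarrow> ('a list \<Rightarrow> 'a) \<Rightarrow> 'a set \<Rightarrow> bool" where
  "hyperideal R m n f g I \<longleftrightarrow> subhypergroup R m f I \<and>
     (\<forall>xs\<in>nlists n R. \<forall>i<n. \<forall>a\<in>I. g (xs[i := a]) \<in> I)"

text \<open>
  \<open>listset Us\<close> is the set of lists whose entries are taken from the respective sets in \<open>Us\<close>,
  so \<open>g ` listset Us\<close> is the elementwise extension of \<open>g\<close> to subsets.
\<close>

definition prime_hyperideal ::
  "'a set \<Rightarrow> nat \<Rightarrow> nat \<Rightarrow> ('a list \<Rightarrow> 'a set) \<Rightarrow> ('a list \<Rightarrow> 'a) \<Rightarrow> 'a set \<Rightarrow> bool" where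
  "prime_hyperideal R m n f g P \<longleftrightarrow> hyperideal R m n f g P \<and> P \<noteq> R \<and>
     (\<forall>Us\<in>nlists n {U. hyperideal R m n f g U}. g ` listset Us \<subseteq> P \<longrightarrow> (\<exists>U\<in>set Us. U \<subseteq> P))"

text \<open>If no prime hyperideal contains \<open>I\<close>, then the radical is \<open>R\<close>.\<close>

definition hyper_radical ::
  "'a set \<Rightarrow> nat \<Rightarrow> nat \<Rightarrow> ('a list \<Rightarrow> 'a set) \<Rightarrow> ('a list \<Rightarrow> 'a) \<Rightarrow> 'a set \<Rightarrow> 'a set" where
  "hyper_radical R m n f g I = R \<inter> \<Inter> {P. prime_hyperideal R m n f g P \<and> I \<subseteq> P}"

definition primary_hyperideal ::
  "'a set \<Rightarrow> nat \<Rightarrow> nat \<Rightarrow> ('a list \<Rightarrow> 'a set) \<Rightarrow> ('a list \<Rightarrow> 'a) \<Rightarrow> 'a \<Rightarrow> 'a set \<Rightarrow> bool" where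
  "primary_hyperideal R m n f g e I \<longleftrightarrow> hyperideal R m n f g I \<and> I \<noteq> R \<and>
     (\<forall>xs\<in>nlists n R. g xs \<in> I \<longrightarrow>
        (\<forall>i<n. xs ! i \<in> I \<or> g (xs[i := e]) \<in> hyper_radical R m n f g I))"

definition multiplicative_subset ::
  "'a set \<Rightarrow> nat \<Rightarrow> ('a list \<Rightarrow> 'a) \<Rightarrow> 'a set \<Rightarrow> bool" where
  "multiplicative_subset R n g S \<longleftrightarrow> S \<subseteq> R \<and> S \<noteq> {} \<and> (\<forall>ss\<in>nlists n S. g ss \<in> S)"

definition S_primary_hyperideal ::
  "'a set \<Rightarrow> nat \<Rightarrow> nat \<Rightarrow> ('a list \<Rightarrow> 'a set) \<Rightarrow> ('a list \<Rightarrow> 'a) \<Rightarrow> 'a \<Rightarrow> 'a set \<Rightarrow> 'a set \<Rightarrow> bool" where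
  "S_primary_hyperideal R m n f g e S I \<longleftrightarrow> hyperideal R m n f g I \<and> I \<inter> S = {} \<and>
     (\<exists>s\<in>S. \<forall>xs\<in>nlists n R. g xs \<in> I \<longrightarrow>
        (\<forall>i<n. g (s # xs ! i # replicate (n - 2) e) \<in> I \<or>
               g (xs[i := s]) \<in> hyper_radical R m n f g I))"

definition hyper_colon :: "'a set \<Rightarrow> nat \<Rightarrow> ('a list \<Rightarrow> 'a) \<Rightarrow> 'a \<Rightarrow> 'a set \<Rightarrow> 'a \<Rightarrow> 'a set" where
  "hyper_colon R n g e I s = {x \<in> R. g (x # s # replicate (n - 2) e) \<in> I}"

end

theory Submission
  imports Defs "HOL-Algebra.Group"
begin

text \<open>
  Since there is a scalar identity, \<open>g\<close> is the \<open>n\<close>-fold product of the commutative monoid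
  \<open>a \<odot> b = g(a, b, 1, \<dots>, 1)\<close>, so prime, primary and \<open>S\<close>-primary can be tested on products of two
  elements.  If \<open>I\<close> is \<open>S\<close>-primary via \<open>s\<close> and \<open>a \<odot> b \<in> (I : s)\<close> but \<open>s \<odot> a \<notin> I\<close>, then
  \<open>s\<^sup>2 \<odot> b \<in> \<surd>I\<close>, so some \<open>b\<^sup>k \<odot> s\<^sup>2\<^sup>k\<close> lies in \<open>I\<close> by Krull's description of the radical; as no power of
  \<open>s\<close> lies in \<open>\<surd>I\<close>, this forces \<open>s \<odot> b\<^sup>k \<in> I\<close>, that is, \<open>b\<^sup>k \<in> (I : s)\<close>.  Conversely, a prime
  containing \<open>I\<close> but not \<open>s\<close> contains \<open>(I : s)\<close>, hence \<open>s \<odot> \<surd>(I : s) \<subseteq> \<surd>I\<close>, and the same \<open>s\<close> works.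
\<close>

text \<open>As simplification rules, these two loop together with \<open>in_nlists\<close>.\<close>

declare nlistsE_length [simp del] nlistsE_set [simp del]

lemma in_nlists: "xs \<in> nlists k A \<longleftrightarrow> length xs = k \<and> set xs \<subseteq> A"
  by (simp add: nlists_def)

section \<open>The \<open>n\<close>-ary operation as an iterated product in a commutative
  monoid\<close>

locale unital_krasner_hyperring = krasner_hyperring R m n f g
  for R :: "'a set" and m n :: nat and f :: "'a list \<Rightarrow> 'a set" and g :: "'a list \<Rightarrow> 'a" +
  fixes e :: 'a
  assumes scalar_id: "scalar_identity R n g e"
begin

text \<open>As a \<open>monoid\<close> record, the binary product inherits powers and the
  commutative monoid laws from HOL-Algebra.\<close>

definition M :: "'a monoid" where
  "M = \<lparr>carrier = R, mult = (\<lambda>a b. g (a # b # replicate (n - 2) e)), one = e\<rparr>"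

abbreviation mul :: "'a \<Rightarrow> 'a \<Rightarrow> 'a"  (infixl "\<odot>" 70) where
  "a \<odot> b \<equiv> a \<otimes>\<^bsub>M\<^esub> b"

abbreviation pow :: "'a \<Rightarrow> nat \<Rightarrow> 'a"  (infixr "\<up>" 75) where
  "a \<up> k \<equiv> a [^]\<^bsub>M\<^esub> k"

abbreviation is_hyperideal :: "'a set \<Rightarrow> bool" where
  "is_hyperideal \<equiv> hyperideal R m n f g"

abbreviation is_prime :: "'a set \<Rightarrow> bool" where
  "is_prime \<equiv> prime_hyperideal R m n f g"

abbreviation rad :: "'a set \<Rightarrow> 'a set" where
  "rad \<equiv> hyper_radical R m n f g"

abbreviation colon :: "'a set \<Rightarrow> 'a \<Rightarrow> 'a set" where
  "colon \<equiv> hyper_colon R n g e"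

lemma mul_eq: "a \<odot> b = g (a # b # replicate (n - 2) e)"
  by (simp add: M_def)

lemma carrier_M [simp]: "carrier M = R"
  by (simp add: M_def)

lemma one_M [simp]: "\<one>\<^bsub>M\<^esub> = e"
  by (simp add: M_def)

lemma e_in [simp]: "e \<in> R"
  using scalar_id unfolding scalar_identity_def by blast

lemma g_scalar: "x \<in> R \<Longrightarrow> g (x # replicate (n - 1) e) = x"
  using scalar_id unfolding scalar_identity_def by blast

lemma mul_comm: assumes "a \<in> R" "b \<in> R" shows "a \<odot> b = b \<odot> a"
  unfolding mul_eq using arity_g assms by (intro g_perm) (auto simp: in_nlists)

text \<open>Associativity of \<open>g\<close> on the tuple \<open>a\<close>, \<open>b\<close>,
  \<open>e\<close>, ..., \<open>e\<close>, \<open>c\<close>, \<open>e\<close>, ..., \<open>e\<close>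
  of length \<open>2 * n - 1\<close>, with the inner product starting at position 0 or at position
  1.\<close>

lemma mul_assoc:
  assumes "a \<in> R" "b \<in> R" "c \<in> R"
  shows "(a \<odot> b) \<odot> c = a \<odot> (b \<odot> c)"
proof -
  obtain k where k: "n = Suc (Suc k)" using arity_g that[of "n - 2"] by simp
  let ?E = "replicate k e"
  have "g (take 0 (a # b # ?E @ c # ?E) @ g (take n (drop 0 (a # b # ?E @ c # ?E)))
          # drop (0 + n) (a # b # ?E @ c # ?E)) =
        g (take 1 (a # b # ?E @ c # ?E) @ g (take n (drop 1 (a # b # ?E @ c # ?E)))
          # drop (1 + n) (a # b # ?E @ c # ?E))"
    by (rule g_assoc) (use assms k in \<open>auto simp: in_nlists\<close>)
  then have "(a \<odot> b) \<odot> c = g (a # g (b # ?E @ [c]) # ?E)"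
    unfolding mul_eq by (simp add: k)
  also have "g (b # ?E @ [c]) = b \<odot> c"
    unfolding mul_eq using assms k by (intro g_perm) (auto simp: in_nlists)
  finally show ?thesis unfolding mul_eq by (simp add: k)
qed

sublocale M: comm_monoid M
proof (rule comm_monoidI)
  fix x y assume "x \<in> carrier M" "y \<in> carrier M"
  then show "x \<odot> y \<in> carrier M"
    using arity_g by (auto simp: mul_eq in_nlists intro!: g_closed)
next
  fix x assume x: "x \<in> carrier M"
  have "x \<odot> e = x"
    using x g_scalar[of x] arity_g Suc_diff_le[of 2 n]
    by (simp add: mul_eq numeral_2_eq_2 flip: replicate_Suc)
  then show "\<one>\<^bsub>M\<^esub> \<odot> x = x" using x mul_comm[of x e] by simp
qed (simp_all add: mul_assoc mul_comm)

lemma mul_in [simp]: "a \<in> R \<Longrightarrow> b \<in> R \<Longrightarrow> a \<odot> b \<in> R"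
  using M.m_closed by simp

lemma mul_e [simp]: "a \<in> R \<Longrightarrow> a \<odot> e = a" "a \<in> R \<Longrightarrow> e \<odot> a = a"
  using M.r_one M.l_one by simp_all

lemma pow_in [simp]: "a \<in> R \<Longrightarrow> a \<up> k \<in> R"
  using M.nat_pow_closed by simp

lemmas mul_ac = M.m_assoc[simplified] M.m_comm[simplified] M.m_lcomm[simplified]

text \<open>Associativity of \<open>g\<close> on \<open>a\<close>, \<open>ys\<close>,
  \<open>e\<close>, ..., \<open>e\<close>: bracketing the first \<open>n\<close> entries leaves
  \<open>g (a # ys)\<close> by the scalar identity, while starting one place later separates
  \<open>a\<close> from \<open>ys\<close>.\<close>

lemma g_Cons:
  assumes a: "a \<in> R" and ys: "ys \<in> nlists (n - 1) R"
  shows "g (a # ys) = a \<odot> g (e # ys)"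
proof -
  obtain k where k: "n = Suc (Suc k)" using arity_g that[of "n - 2"] by simp
  let ?L = "a # ys @ e # replicate k e"
  have "g (take 0 ?L @ g (take n (drop 0 ?L)) # drop (0 + n) ?L) =
        g (take 1 ?L @ g (take n (drop 1 ?L)) # drop (1 + n) ?L)"
    by (rule g_assoc) (use assms k in \<open>auto simp: in_nlists\<close>)
  then have "g (g (a # ys) # e # replicate k e) = g (a # g (ys @ [e]) # replicate k e)"
    using ys k by (simp add: in_nlists)
  moreover have "g (g (a # ys) # e # replicate k e) = g (a # ys)"
    using g_scalar[of "g (a # ys)"] g_closed[of "a # ys"] assms k by (auto simp: in_nlists)
  moreover have "g (ys @ [e]) = g (e # ys)"
    using assms k by (intro g_perm) (auto simp: in_nlists)
  ultimately show ?thesis unfolding mul_eq by (simp add: k)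
qed

text \<open>Permutation invariance brings position \<open>i\<close> to the front, where
  \<open>g_Cons\<close> applies.\<close>

lemma g_update:
  assumes xs: "xs \<in> nlists n R" and i: "i < n" and a: "a \<in> R"
  shows "g (xs[i := a]) = a \<odot> g (xs[i := e])"
proof -
  define ys where "ys = take i xs @ drop (Suc i) xs"
  have ys: "ys \<in> nlists (n - 1) R"
    using xs i unfolding ys_def by (auto simp: in_nlists dest: in_set_takeD in_set_dropD)
  have eq: "g (xs[i := b]) = g (b # ys)" if "b \<in> R" for b
  proof (rule g_perm)
    show "b # ys \<in> nlists n R" using ys that arity_g by (auto simp: in_nlists)
    show "mset (xs[i := b]) = mset (b # ys)"
      using xs i by (simp add: ys_def upd_conv_take_nth_drop in_nlists)
  qed
  show ?thesis using eq a g_Cons[OF a ys] by simp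
qed

lemma g_split:
  assumes "xs \<in> nlists n R" "i < n"
  shows "g xs = xs ! i \<odot> g (xs[i := e])"
proof -
  have "xs ! i \<in> R" using assms by (auto simp: in_nlists)
  from g_update[OF assms this] show ?thesis by simp
qed

lemma update_in: "xs \<in> nlists k A \<Longrightarrow> a \<in> A \<Longrightarrow> xs[i := a] \<in> nlists k A"
  by (auto simp: in_nlists dest: set_update_subset_insert[THEN subsetD])

lemma g_eq_foldr:
  assumes "xs \<in> nlists n R"
  shows "g xs = foldr (\<odot>) xs e"
proof -
  \<comment> \<open>Since \<open>g\<close> is meaningful only on \<open>n\<close> arguments, the
    induction runs over shorter lists padded with \<open>e\<close>.\<close>
  have "g (ys @ replicate (n - length ys) e) = foldr (\<odot>) ys e"
    if "length ys \<le> n" "set ys \<subseteq> R" for ys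
    using that
  proof (induction ys)
    case Nil
    show ?case using g_scalar[OF e_in] arity_g by (simp flip: replicate_Suc)
  next
    case (Cons a ys)
    have "g (a # ys @ replicate (n - Suc (length ys)) e)
        = a \<odot> g (e # ys @ replicate (n - Suc (length ys)) e)"
      by (rule g_Cons) (use Cons.prems in \<open>auto simp: in_nlists\<close>)
    also have "g (e # ys @ replicate (n - Suc (length ys)) e) = g (ys @ replicate (n - length ys) e)"
    proof (rule g_perm)
      show "ys @ replicate (n - length ys) e \<in> nlists n R"
        using Cons.prems by (auto simp: in_nlists)
      have "n - length ys = Suc (n - Suc (length ys))" using Cons.prems by simp
      then show "mset (e # ys @ replicate (n - Suc (length ys)) e)
          = mset (ys @ replicate (n - length ys) e)" by simp
    qed
    finally show ?case using Cons by simp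
  qed
  from this[of xs] show ?thesis using assms by (simp add: in_nlists)
qed

section \<open>Zero, negatives and hyperideals in terms of the binary product\<close>

abbreviation zero :: 'a where "zero \<equiv> hyper_zero R m f"
abbreviation neg :: "'a \<Rightarrow> 'a" where "neg \<equiv> hyper_neg R m f"

lemma zero_in [simp]: "zero \<in> R"
  using theI'[OF zero_ex1] unfolding hyper_zero_def by blast

lemma neg_in [simp]: "x \<in> R \<Longrightarrow> neg x \<in> R"
  and zero_in_f_neg: "x \<in> R \<Longrightarrow> zero \<in> f (x # neg x # replicate (m - 2) zero)"
  using theI'[OF neg_ex1[of x]] unfolding hyper_neg_def by blast+

lemma neg_eqI: "x \<in> R \<Longrightarrow> y \<in> R \<Longrightarrow> zero \<in> f (x # y # replicate (m - 2) zero) \<Longrightarrow> y = neg x"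
  using neg_ex1[of x] zero_in_f_neg[of x] neg_in[of x] by blast

lemma zero_mul [simp]: "x \<in> R \<Longrightarrow> zero \<odot> x = zero"
  unfolding mul_eq by (rule g_zero) (use arity_g in \<open>auto simp: in_nlists\<close>)

lemma mul_f_image:
  assumes a: "a \<in> R" and xs: "xs \<in> nlists m R"
  shows "(\<lambda>y. y \<odot> a) ` f xs = f (map (\<lambda>x. x \<odot> a) xs)"
proof -
  \<comment> \<open>The leading \<open>e\<close> is a placeholder that the update at position 0
    overwrites.\<close>
  have "(\<lambda>y. g ((e # a # replicate (n - 2) e)[0 := y])) ` f xs
      = f (map (\<lambda>x. g ((e # a # replicate (n - 2) e)[0 := x])) xs)"
    by (rule g_distrib) (use assms arity_g in \<open>auto simp: in_nlists\<close>)
  then show ?thesis by (simp add: mul_eq)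
qed

text \<open>Multiplying the relation that characterises \<open>neg x\<close> by \<open>a\<close>
  gives the one that characterises \<open>neg (x \<odot> a)\<close>; negatives are unique.\<close>

lemma neg_mul:
  assumes "x \<in> R" "a \<in> R"
  shows "neg x \<odot> a = neg (x \<odot> a)"
proof (rule neg_eqI)
  have "zero \<odot> a \<in> (\<lambda>y. y \<odot> a) ` f (x # neg x # replicate (m - 2) zero)"
    using zero_in_f_neg assms by blast
  also have "\<dots> = f (map (\<lambda>x. x \<odot> a) (x # neg x # replicate (m - 2) zero))"
    by (rule mul_f_image) (use assms arity_f in \<open>auto simp: in_nlists\<close>)
  finally show "zero \<in> f (x \<odot> a # neg x \<odot> a # replicate (m - 2) zero)"
    using assms by simp
qed (use assms in auto)

lemma hyperideal_subset: "is_hyperideal J \<Longrightarrow> J \<subseteq> R"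
  and hyperideal_nonempty: "is_hyperideal J \<Longrightarrow> J \<noteq> {}"
  and hyperideal_f: "is_hyperideal J \<Longrightarrow> xs \<in> nlists m J \<Longrightarrow> f xs \<subseteq> J"
  by (auto simp: hyperideal_def subhypergroup_def)

lemma hyperideal_mul:
  assumes J: "is_hyperideal J" and "a \<in> J" "r \<in> R"
  shows "a \<odot> r \<in> J" "r \<odot> a \<in> J"
proof -
  have "\<forall>xs\<in>nlists n R. \<forall>i<n. \<forall>a\<in>J. g (xs[i := a]) \<in> J"
    using J by (simp add: hyperideal_def)
  moreover have "e # r # replicate (n - 2) e \<in> nlists n R" "0 < n"
    using arity_g assms by (auto simp: in_nlists)
  ultimately have "g ((e # r # replicate (n - 2) e)[0 := a]) \<in> J" using \<open>a \<in> J\<close> by blast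
  then show "a \<odot> r \<in> J" by (simp add: mul_eq)
  moreover have "a \<in> R" using assms hyperideal_subset by blast
  ultimately show "r \<odot> a \<in> J" using mul_comm[of a r] \<open>r \<in> R\<close> by simp
qed

lemma hyperideal_zero: assumes J: "is_hyperideal J" shows "zero \<in> J"
proof -
  obtain a where "a \<in> J" "a \<in> R" using hyperideal_nonempty[OF J] hyperideal_subset[OF J] by blast
  then show ?thesis using hyperideal_mul(2)[OF J, of a zero] by simp
qed

text \<open>Solvability inside \<open>J\<close> provides some \<open>y\<close> in \<open>J\<close>
  with \<open>zero\<close> in the hypersum of \<open>x\<close>, \<open>y\<close> and zeros;
  uniqueness makes it \<open>neg x\<close>.\<close>

lemma hyperideal_neg:
  assumes J: "is_hyperideal J" and x: "x \<in> J"
  shows "neg x \<in> J"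
proof -
  have z: "zero \<in> J" by (rule hyperideal_zero[OF J])
  have "\<forall>bs\<in>nlists m J. \<forall>i<m. \<forall>b\<in>J. \<exists>x\<in>J. b \<in> f (bs[i := x])"
    using J by (simp add: hyperideal_def subhypergroup_def)
  moreover have "x # zero # replicate (m - 2) zero \<in> nlists m J" "1 < m"
    using arity_f x z by (auto simp: in_nlists)
  ultimately obtain y where "y \<in> J" "zero \<in> f ((x # zero # replicate (m - 2) zero)[1 := y])"
    using z by blast
  then show ?thesis using neg_eqI[of x y] x hyperideal_subset[OF J] by auto
qed

text \<open>Closure under negation stands in for solvability: by reversibility, a solution
  \<open>x\<close> in \<open>R\<close> of \<open>b \<in> f (bs[i := x])\<close> lies in the hypersum
  of \<open>b\<close> and the negatives of the other entries of \<open>bs\<close>, hence in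
  \<open>J\<close>.\<close>

lemma hyperidealI:
  assumes sub: "J \<subseteq> R" and ne: "J \<noteq> {}"
    and f: "\<And>xs. xs \<in> nlists m J \<Longrightarrow> f xs \<subseteq> J"
    and neg: "\<And>x. x \<in> J \<Longrightarrow> neg x \<in> J"
    and mul: "\<And>x r. x \<in> J \<Longrightarrow> r \<in> R \<Longrightarrow> x \<odot> r \<in> J"
  shows "is_hyperideal J"
  unfolding hyperideal_def subhypergroup_def
proof (intro conjI ballI allI impI)
  fix bs i b assume bs: "bs \<in> nlists m J" and i: "i < m" and b: "b \<in> J"
  have bsR: "bs \<in> nlists m R" using bs sub by (auto simp: in_nlists)
  then obtain x where x: "x \<in> R" "b \<in> f (bs[i := x])"
    using f_solvable i b sub by blast
  have "bs[i := x] ! i \<in> f (b # map neg (take i (bs[i := x]) @ drop (Suc i) (bs[i := x])))"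
    by (rule reversible) (use x i bsR update_in in auto)
  then have "x \<in> f (b # map neg (take i bs @ drop (Suc i) bs))"
    using bs i by (simp add: in_nlists)
  moreover have "b # map neg (take i bs @ drop (Suc i) bs) \<in> nlists m J"
    using bs i b neg by (auto simp: in_nlists dest!: in_set_takeD in_set_dropD)
  ultimately show "\<exists>x\<in>J. b \<in> f (bs[i := x])" using f x(2) by blast
next
  fix xs i a assume xs: "xs \<in> nlists n R" and i: "i < n" and a: "a \<in> J"
  then show "g (xs[i := a]) \<in> J"
    using g_update[OF xs i, of a] mul[OF a] g_closed[OF update_in[OF xs e_in]] sub by auto
qed (use sub ne f in blast)+

lemma hyperideal_R: "is_hyperideal R"
  by (rule hyperidealI) (use f_closed zero_in neg_in mul_in in blast)+

text \<open>Primes are defined by products of hyperideals; these are the ones that test single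
  elements. Distributivity pulls \<open>a\<close> out of a hypersum of multiples.\<close>

lemma hyperideal_principal:
  assumes a: "a \<in> R"
  shows "is_hyperideal ((\<lambda>r. r \<odot> a) ` R)"
proof (rule hyperidealI)
  fix xs assume xs: "xs \<in> nlists m ((\<lambda>r. r \<odot> a) ` R)"
  \<comment> \<open>A cofactor is chosen for each entry, so that \<open>xs\<close> is
    \<open>ys\<close> multiplied entrywise by \<open>a\<close>.\<close>
  define ys where "ys = map (inv_into R (\<lambda>r. r \<odot> a)) xs"
  have "map (\<lambda>r. r \<odot> a) ys = xs"
    unfolding ys_def map_map
    by (rule map_idI) (use xs in \<open>auto simp: in_nlists f_inv_into_f[of _ "\<lambda>r. r \<odot> a"]\<close>)
  moreover have "ys \<in> nlists m R"
    using xs by (auto simp: ys_def in_nlists intro!: inv_into_into)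
  ultimately show "f xs \<subseteq> (\<lambda>r. r \<odot> a) ` R"
    using mul_f_image[OF a, of ys] f_closed[of ys] by auto
next
  fix x r assume "x \<in> (\<lambda>r. r \<odot> a) ` R" "r \<in> R"
  then obtain y where y: "y \<in> R" "x = y \<odot> a" "r \<in> R" by blast
  then have "x \<odot> r = (y \<odot> r) \<odot> a" using a by (simp add: mul_ac)
  then show "x \<odot> r \<in> (\<lambda>r. r \<odot> a) ` R" using y by auto
qed (use a zero_in in \<open>auto simp flip: neg_mul\<close>)

section \<open>Colon hyperideals\<close>

lemma colon_eq: "colon J a = {x \<in> R. x \<odot> a \<in> J}"
  by (simp add: hyper_colon_def mul_eq)

lemma hyperideal_colon:
  assumes J: "is_hyperideal J" and a: "a \<in> R"
  shows "is_hyperideal (colon J a)"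
proof (rule hyperidealI)
  have "zero \<in> colon J a" using hyperideal_zero[OF J] a by (simp add: colon_eq)
  then show "colon J a \<noteq> {}" by blast
next
  fix xs assume xs: "xs \<in> nlists m (colon J a)"
  then have xsR: "xs \<in> nlists m R" by (auto simp: in_nlists colon_eq)
  have "f (map (\<lambda>x. x \<odot> a) xs) \<subseteq> J"
    by (rule hyperideal_f[OF J]) (use xs in \<open>auto simp: in_nlists colon_eq\<close>)
  then show "f xs \<subseteq> colon J a"
    using mul_f_image[OF a xsR] f_closed[OF xsR] by (auto simp: colon_eq)
next
  fix x r assume "x \<in> colon J a" "r \<in> R"
  then have x: "x \<in> R" "r \<in> R" "x \<odot> a \<odot> r \<in> J"
    using hyperideal_mul(1)[OF J, of "x \<odot> a" r] by (simp_all add: colon_eq)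
  moreover have "x \<odot> r \<odot> a = x \<odot> a \<odot> r" using x a by (simp add: mul_ac)
  ultimately show "x \<odot> r \<in> colon J a" by (simp add: colon_eq)
qed (use assms in \<open>auto simp: colon_eq neg_mul hyperideal_neg\<close>)

lemma subset_colon: "is_hyperideal J \<Longrightarrow> a \<in> R \<Longrightarrow> J \<subseteq> colon J a"
  using hyperideal_mul(1)[of J] hyperideal_subset[of J] by (auto simp: colon_eq)

lemma hyperideal_eq_R_iff: "is_hyperideal J \<Longrightarrow> J = R \<longleftrightarrow> e \<in> J"
  using hyperideal_mul(2)[of J e] hyperideal_subset[of J] by force

section \<open>Prime hyperideals tested on products of two elements\<close>

text \<open>The definition is applied to the principal hyperideals of \<open>a\<close> and
  \<open>b\<close> and to \<open>n - 2\<close> copies of \<open>R\<close>: every product formed from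
  them is a multiple of \<open>a \<odot> b\<close>, and \<open>R\<close> itself is not contained in
  \<open>P\<close>.\<close>

lemma prime_mulD:
  assumes P: "is_prime P" and ab: "a \<in> R" "b \<in> R" "a \<odot> b \<in> P"
  shows "a \<in> P \<or> b \<in> P"
proof -
  have hP: "is_hyperideal P" and "P \<noteq> R" using P by (auto simp: prime_hyperideal_def)
  let ?pr = "\<lambda>a. (\<lambda>r. r \<odot> a) ` R"
  let ?Us = "?pr a # ?pr b # replicate (n - 2) R"
  have lsR: "listset (replicate k R) = nlists k R" for k
    by (induction k) (auto simp: set_Cons_def in_nlists length_Suc_conv)
  have Us: "?Us \<in> nlists n {U. is_hyperideal U}"
    using arity_g ab hyperideal_principal hyperideal_R by (auto simp: in_nlists)
  have "g ` listset ?Us \<subseteq> P"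
  proof clarify
    fix ys assume "ys \<in> listset ?Us"
    then obtain r r' zs where ys: "ys = (r \<odot> a) # (r' \<odot> b) # zs" "r \<in> R" "r' \<in> R"
      "zs \<in> nlists (n - 2) R"
      by (auto simp: set_Cons_def lsR)
    have w: "foldr (\<odot>) zs e \<in> R" if "set zs \<subseteq> R" for zs
      using that by (induction zs) auto
    have "ys \<in> nlists n R" using ys arity_g ab by (auto simp: in_nlists)
    then have "g ys = (r \<odot> a) \<odot> ((r' \<odot> b) \<odot> foldr (\<odot>) zs e)"
      using g_eq_foldr ys by simp
    also have "\<dots> = (a \<odot> b) \<odot> (r \<odot> (r' \<odot> foldr (\<odot>) zs e))"
      using ys ab w[of zs] by (simp add: mul_ac in_nlists)
    also have "\<dots> \<in> P"
      using hyperideal_mul(1)[OF hP ab(3)] ys w[of zs] by (auto simp: in_nlists)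
    finally show "g ys \<in> P" .
  qed
  then obtain U where "U \<in> set ?Us" "U \<subseteq> P"
    using P Us unfolding prime_hyperideal_def by blast
  moreover have "\<not> R \<subseteq> P" using \<open>P \<noteq> R\<close> hyperideal_subset[OF hP] by blast
  moreover have "c \<in> ?pr c" if "c \<in> R" for c using that by (auto intro!: image_eqI[of _ _ e])
  ultimately show ?thesis using ab by (auto split: if_splits)
qed

text \<open>If no member of \<open>Us\<close> were contained in \<open>P\<close>, each would supply
  an element outside \<open>P\<close>. By induction from \<open>e \<notin> P\<close>, the product of
  these elements would also lie outside \<open>P\<close>.\<close>

lemma primeI:
  assumes P: "is_hyperideal P" "P \<noteq> R"
    and mul: "\<And>a b. a \<in> R \<Longrightarrow> b \<in> R \<Longrightarrow> a \<odot> b \<in> P \<Longrightarrow> a \<in> P \<or> b \<in> P"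
  shows "is_prime P"
  unfolding prime_hyperideal_def
proof (intro conjI ballI impI P)
  fix Us assume Us: "Us \<in> nlists n {U. is_hyperideal U}" and gP: "g ` listset Us \<subseteq> P"
  have R: "foldr (\<odot>) zs e \<in> R" if "set zs \<subseteq> R" for zs
    using that by (induction zs) auto
  have e: "e \<notin> P" using P hyperideal_eq_R_iff by blast
  have notP: "foldr (\<odot>) xs e \<notin> P" if "set xs \<subseteq> R - P" for xs
    using that
  proof (induction xs)
    case Nil
    show ?case using e by simp
  next
    case (Cons x xs)
    then show ?case using mul[of x "foldr (\<odot>) xs e"] R[of xs] by auto
  qed
  show "\<exists>U\<in>set Us. U \<subseteq> P"
  proof (rule ccontr)
    assume "\<not> ?thesis"
    then have "\<forall>U\<in>set Us. \<exists>u. u \<in> U - P" by blast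
    then obtain u where u: "\<forall>U\<in>set Us. u U \<in> U - P" by metis
    have uR: "set (map u Us) \<subseteq> R - P" using u Us hyperideal_subset by (fastforce simp: in_nlists)
    have "map u Us \<in> listset Us" using u by (induction Us) (auto simp: set_Cons_def)
    then have "g (map u Us) \<in> P" using gP by blast
    moreover have "map u Us \<in> nlists n R" using uR Us by (auto simp: in_nlists)
    ultimately show False using g_eq_foldr notP[OF uR] by simp
  qed
qed

section \<open>Krull's description of the radical by powers\<close>

lemma hyperideal_Union_chain:
  assumes C: "C \<noteq> {}" "subset.chain {J. is_hyperideal J} C"
  shows "is_hyperideal (\<Union>C)"
proof (rule hyperidealI)
  have h: "is_hyperideal J" if "J \<in> C" for J using C that by (auto simp: subset.chain_def)
  show "\<Union>C \<subseteq> R" using h hyperideal_subset by blast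
  show "\<Union>C \<noteq> {}" using C h hyperideal_nonempty by blast
  show "f xs \<subseteq> \<Union>C" if xs: "xs \<in> nlists m (\<Union>C)" for xs
  proof -
    \<comment> \<open>Finitely many elements of the union of a chain already lie in one
      member.\<close>
    obtain J where "J \<in> C" "set xs \<subseteq> J"
      using finite_subset_Union_chain[of "set xs" C] C xs by (auto simp: in_nlists)
    then show ?thesis using hyperideal_f[OF h, of J xs] xs by (auto simp: in_nlists)
  qed
  show "neg x \<in> \<Union>C" if "x \<in> \<Union>C" for x using that h hyperideal_neg by blast
  show "x \<odot> r \<in> \<Union>C" if "x \<in> \<Union>C" "r \<in> R" for x r using that h hyperideal_mul(1) by blast
qed

text \<open>
  A hyperideal \<open>J\<close> that is maximal among those avoiding the powers of \<open>x\<close> is prime, and colon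
  hyperideals replace the usual sums in the proof: if \<open>a \<odot> b \<in> J\<close> with \<open>a, b \<notin> J\<close>, then \<open>(J : b)\<close>
  is larger than \<open>J\<close>, so it contains a power \<open>x \<up> k\<close>, and then \<open>(J : x \<up> k)\<close> is larger than \<open>J\<close>
  and contains a power \<open>x \<up> l\<close>, whence \<open>x \<up> (l + k) \<in> J\<close>.
\<close>

lemma rad_powE:
  assumes J0: "is_hyperideal J0" and x: "x \<in> rad J0"
  obtains k where "x \<up> k \<in> J0"
proof (rule ccontr)
  assume "\<not> thesis"
  then have no: "x \<up> k \<notin> J0" for k using that by blast
  have xR: "x \<in> R" using x by (simp add: hyper_radical_def)
  define A where "A = {J. is_hyperideal J \<and> J0 \<subseteq> J \<and> (\<forall>k. x \<up> k \<notin> J)}"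
  have "\<exists>J\<in>A. \<forall>X\<in>A. J \<subseteq> X \<longrightarrow> X = J"
  proof (rule subset_Zorn_nonempty)
    show "A \<noteq> {}" using J0 no by (auto simp: A_def)
    fix C assume C: "C \<noteq> {}" "subset.chain A C"
    then have "is_hyperideal (\<Union>C)"
      by (intro hyperideal_Union_chain) (auto simp: subset.chain_def A_def)
    moreover have "C \<subseteq> A" using C by (simp add: subset.chain_def)
    ultimately show "\<Union>C \<in> A" using C(1) by (auto simp: A_def)
  qed
  then obtain J where J: "J \<in> A" and mx: "\<And>X. X \<in> A \<Longrightarrow> J \<subseteq> X \<Longrightarrow> X = J" by blast
  have hJ: "is_hyperideal J" and noJ: "x \<up> k \<notin> J" and sub: "J0 \<subseteq> J" for k
    using J by (auto simp: A_def)
  have power_in_colon: "\<exists>k. x \<up> k \<odot> c \<in> J" if "c \<in> R" "d \<in> R" "d \<odot> c \<in> J" "d \<notin> J" for c d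
  proof (rule ccontr)
    assume "\<not> ?thesis"
    then have "x \<up> k \<notin> colon J c" for k by (simp add: colon_eq)
    moreover have J: "J \<subseteq> colon J c" using subset_colon[OF hJ that(1)] .
    ultimately have "colon J c \<in> A"
      using hyperideal_colon[OF hJ that(1)] sub by (auto simp: A_def)
    from mx[OF this J] show False using that by (auto simp: colon_eq)
  qed
  have "is_prime J"
  proof (rule primeI[OF hJ])
    \<comment> \<open>The zeroth power of \<open>x\<close> is \<open>e\<close>, so avoiding all
      powers keeps \<open>J\<close> proper.\<close>
    show "J \<noteq> R" using noJ[of 0] by auto
    fix a b assume ab: "a \<in> R" "b \<in> R" "a \<odot> b \<in> J"
    show "a \<in> J \<or> b \<in> J"
    proof (rule ccontr)
      assume "\<not> ?thesis"
      then obtain k where "x \<up> k \<odot> b \<in> J" "b \<notin> J" using power_in_colon[of b a] ab by auto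
      \<comment> \<open>Now \<open>b\<close> witnesses that the colon hyperideal of
        \<open>x \<up> k\<close> exceeds \<open>J\<close>.\<close>
      then obtain l where "x \<up> l \<odot> x \<up> k \<in> J"
        using power_in_colon[of "x \<up> k" b] ab xR by (auto simp: mul_ac)
      then show False using noJ[of "l + k"] xR M.nat_pow_mult[of x l k] by simp
    qed
  qed
  then have "x \<in> J" using x sub by (auto simp: hyper_radical_def)
  then show False using noJ[of 1] xR by simp
qed

lemma prime_powD:
  assumes P: "is_prime P" and x: "x \<in> R" "x \<up> (k::nat) \<in> P"
  shows "x \<in> P"
  using x(2)
proof (induction k)
  case 0
  then show ?case using P hyperideal_eq_R_iff by (auto simp: prime_hyperideal_def)
next
  case (Suc k)
  then show ?case using prime_mulD[OF P, of "x \<up> k" x] x by auto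
qed

text \<open>The converse of \<open>rad_powE\<close>: every prime over \<open>J\<close> contains a
  power of \<open>x\<close>, hence \<open>x\<close>.\<close>

lemma radI: "x \<in> R \<Longrightarrow> x \<up> k \<in> J \<Longrightarrow> x \<in> rad J"
  using prime_powD by (auto simp: hyper_radical_def)

section \<open>Primary and \<open>S\<close>-primary hyperideals tested on two factors\<close>

text \<open>One direction pads \<open>a\<close> and \<open>b\<close> with \<open>e\<close> and tests
  position 0; the other splits \<open>g xs\<close> into \<open>xs ! i\<close> and the product of the
  remaining entries.\<close>

lemma primary_iff:
  "primary_hyperideal R m n f g e J \<longleftrightarrow> is_hyperideal J \<and> J \<noteq> R \<and>
     (\<forall>a\<in>R. \<forall>b\<in>R. a \<odot> b \<in> J \<longrightarrow> a \<in> J \<or> b \<in> rad J)" (is "?L \<longleftrightarrow> ?Q")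
proof
  assume L: ?L
  have "a \<in> J \<or> b \<in> rad J" if ab: "a \<in> R" "b \<in> R" "a \<odot> b \<in> J" for a b
  proof -
    let ?xs = "a # b # replicate (n - 2) e"
    have "?xs \<in> nlists n R" "0 < n" using ab arity_g by (auto simp: in_nlists)
    moreover have "g ?xs \<in> J" using ab by (simp add: mul_eq)
    ultimately have "?xs ! 0 \<in> J \<or> g (?xs[0 := e]) \<in> rad J"
      using L unfolding primary_hyperideal_def by blast
    then show ?thesis using ab mul_e(2)[of b] by (simp add: mul_eq)
  qed
  then show ?Q using L unfolding primary_hyperideal_def by blast
next
  assume Q: ?Q
  have "xs ! i \<in> J \<or> g (xs[i := e]) \<in> rad J"
    if xs: "xs \<in> nlists n R" "g xs \<in> J" "i < n" for xs i
  proof -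
    have "xs ! i \<in> R" using xs by (auto simp: in_nlists)
    moreover have "g (xs[i := e]) \<in> R" using g_closed[OF update_in[OF xs(1) e_in]] .
    moreover have "xs ! i \<odot> g (xs[i := e]) \<in> J" using xs(2) unfolding g_split[OF xs(1,3)] .
    ultimately show ?thesis using Q by blast
  qed
  then show ?L using Q unfolding primary_hyperideal_def by blast
qed

text \<open>The equivalence holds for each fixed \<open>s\<close>, by the argument of
  \<open>primary_iff\<close>; \<open>g_update\<close> extracts the \<open>s\<close> put at position
  \<open>i\<close>.\<close>

lemma S_primary_iff:
  assumes S: "S \<subseteq> R"
  shows "S_primary_hyperideal R m n f g e S J \<longleftrightarrow> is_hyperideal J \<and> J \<inter> S = {} \<and>
     (\<exists>s\<in>S. \<forall>a\<in>R. \<forall>b\<in>R. a \<odot> b \<in> J \<longrightarrow> s \<odot> a \<in> J \<or> s \<odot> b \<in> rad J)"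
proof -
  have eq: "(\<forall>xs\<in>nlists n R. g xs \<in> J \<longrightarrow>
        (\<forall>i<n. g (s # xs ! i # replicate (n - 2) e) \<in> J \<or> g (xs[i := s]) \<in> rad J)) \<longleftrightarrow>
      (\<forall>a\<in>R. \<forall>b\<in>R. a \<odot> b \<in> J \<longrightarrow> s \<odot> a \<in> J \<or> s \<odot> b \<in> rad J)" (is "?L \<longleftrightarrow> ?Q")
    if s: "s \<in> S" for s
  proof
    assume L: ?L
    show ?Q
    proof (intro ballI impI)
      fix a b assume ab: "a \<in> R" "b \<in> R" "a \<odot> b \<in> J"
      let ?xs = "a # b # replicate (n - 2) e"
      have "?xs \<in> nlists n R" "0 < n" using ab arity_g by (auto simp: in_nlists)
      moreover have "g ?xs \<in> J" using ab by (simp add: mul_eq)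
      ultimately have "g (s # ?xs ! 0 # replicate (n - 2) e) \<in> J \<or> g (?xs[0 := s]) \<in> rad J"
        using L by blast
      then show "s \<odot> a \<in> J \<or> s \<odot> b \<in> rad J" by (simp add: mul_eq)
    qed
  next
    assume Q: ?Q
    show ?L
    proof (intro ballI impI allI)
      fix xs i assume xs: "xs \<in> nlists n R" "g xs \<in> J" "i < n"
      have "xs ! i \<in> R" using xs by (auto simp: in_nlists)
      moreover have "g (xs[i := e]) \<in> R" using g_closed[OF update_in[OF xs(1) e_in]] .
      moreover have "xs ! i \<odot> g (xs[i := e]) \<in> J" using xs(2) unfolding g_split[OF xs(1,3)] .
      ultimately have "s \<odot> xs ! i \<in> J \<or> s \<odot> g (xs[i := e]) \<in> rad J" using Q by blast
      moreover have "g (xs[i := s]) = s \<odot> g (xs[i := e])" using g_update xs s S by blast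
      ultimately show "g (s # xs ! i # replicate (n - 2) e) \<in> J \<or> g (xs[i := s]) \<in> rad J"
        by (simp add: mul_eq)
    qed
  qed
  show ?thesis
    unfolding S_primary_hyperideal_def
    by (rule conj_cong[OF refl], rule conj_cong[OF refl], rule bex_cong[OF refl], rule eq)
qed

section \<open>Powers of elements of \<open>S\<close> and the radical\<close>

text \<open>Only exponents congruent to 1 modulo \<open>n - 1\<close> are guaranteed to stay in \<open>S\<close>.\<close>

lemma multiplicative_subset_pow:
  assumes S: "multiplicative_subset R n g S" and s: "s \<in> S"
  shows "s \<up> (1 + k * (n - 1)) \<in> S"
proof (induction k)
  case 0
  then show ?case using S s by (auto simp: multiplicative_subset_def)
next
  case (Suc k)
  have sR: "s \<in> R" and SR: "S \<subseteq> R" using S s by (auto simp: multiplicative_subset_def)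
  let ?t = "s \<up> (1 + k * (n - 1))"
  \<comment> \<open>Combining \<open>n - 1\<close> further factors \<open>s\<close> with the
    previous power raises the exponent by \<open>n - 1\<close>.\<close>
  let ?xs = "replicate (n - 1) s @ [?t]"
  have xs: "?xs \<in> nlists n S" using s Suc arity_g by (auto simp: in_nlists)
  have fold: "foldr (\<odot>) (replicate j s) t = s \<up> j \<odot> t" if "t \<in> R" for j t
    using that sR by (induction j) (auto simp: mul_ac)
  have "g ?xs = foldr (\<odot>) ?xs e" using xs SR by (intro g_eq_foldr) (auto simp: in_nlists)
  also have "\<dots> = s \<up> (n - 1) \<odot> ?t" using fold sR by (simp del: M.nat_pow_Suc)
  also have "\<dots> = s \<up> (n - 1 + (1 + k * (n - 1)))"
    by (rule M.nat_pow_mult) (simp add: sR)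
  also have "n - 1 + (1 + k * (n - 1)) = 1 + Suc k * (n - 1)" by simp
  finally have "g ?xs = s \<up> (1 + Suc k * (n - 1))" .
  then show ?case using S xs unfolding multiplicative_subset_def by metis
qed

text \<open>Otherwise \<open>rad_powE\<close> puts some power \<open>s \<up> N\<close> into
  \<open>J\<close>. As \<open>n \<ge> 2\<close>, the exponent \<open>1 + N * (n - 1)\<close> is at
  least \<open>N\<close>, so the corresponding power of \<open>s\<close> lies in both
  \<open>J\<close> and \<open>S\<close>.\<close>

lemma disjoint_rad_pow:
  assumes S: "multiplicative_subset R n g S" and J: "is_hyperideal J" "J \<inter> S = {}" and s: "s \<in> S"
  shows "s \<up> k \<notin> rad J"
proof
  have sR: "s \<in> R" using S s by (auto simp: multiplicative_subset_def)
  assume "s \<up> k \<in> rad J"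
  then obtain l where l: "(s \<up> k) \<up> l \<in> J" using rad_powE[OF J(1)] by blast
  define N where "N = k * l"
  have N: "s \<up> N \<in> J" using l sR by (simp add: N_def M.nat_pow_pow)
  have "N \<le> 1 + N * (n - 1)" using arity_g by (cases "n - 1") auto
  then obtain d where d: "1 + N * (n - 1) = N + d" using le_Suc_ex by blast
  have "s \<up> (N + d) \<in> J"
    using hyperideal_mul(1)[OF J(1) N, of "s \<up> d"] sR M.nat_pow_mult[of s N d] by simp
  moreover have "s \<up> (N + d) \<in> S"
    using multiplicative_subset_pow[OF S s, of N] unfolding d .
  ultimately show False using J(2) by blast
qed

section \<open>The two directions of the equivalence\<close>

lemma S_primary_imp_colon_primary:
  assumes S: "multiplicative_subset R n g S" and I: "is_hyperideal I" "I \<inter> S = {}"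
    and s: "s \<in> S"
    and prim: "\<And>a b. a \<in> R \<Longrightarrow> b \<in> R \<Longrightarrow> a \<odot> b \<in> I \<Longrightarrow> s \<odot> a \<in> I \<or> s \<odot> b \<in> rad I"
  shows "primary_hyperideal R m n f g e (colon I s)"
  unfolding primary_iff
proof (intro conjI ballI impI)
  have sR: "s \<in> R" using S s by (auto simp: multiplicative_subset_def)
  show "is_hyperideal (colon I s)" using hyperideal_colon I sR by blast
  \<comment> \<open>The product of \<open>e\<close> and \<open>s\<close> is \<open>s\<close>, which
    lies in \<open>S\<close> and so not in \<open>I\<close>.\<close>
  have "e \<notin> colon I s" using s sR I by (auto simp: colon_eq)
  then show "colon I s \<noteq> R" by auto
  fix a b assume ab: "a \<in> R" "b \<in> R" "a \<odot> b \<in> colon I s"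
  show "a \<in> colon I s \<or> b \<in> rad (colon I s)"
  proof (cases "s \<odot> a \<in> I")
    case True
    then show ?thesis using ab sR by (simp add: colon_eq mul_ac)
  next
    case False
    moreover have "a \<odot> (b \<odot> s) \<in> I" using ab sR by (simp add: colon_eq mul_ac)
    ultimately have "s \<odot> (b \<odot> s) \<in> rad I" using prim[of a "b \<odot> s"] ab sR by auto
    then obtain k where "(s \<odot> (b \<odot> s)) \<up> k \<in> I" using rad_powE[OF I(1)] by blast
    moreover have "s \<odot> (b \<odot> s) = b \<odot> s \<up> 2" using ab sR by (simp add: numeral_2_eq_2 mul_ac)
    moreover have "(b \<odot> s \<up> 2) \<up> k = b \<up> k \<odot> s \<up> (2 * k)"
      using ab sR by (simp add: M.nat_pow_distrib M.nat_pow_pow)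
    ultimately have bs: "b \<up> k \<odot> s \<up> (2 * k) \<in> I" by simp
    \<comment> \<open>The hypothesis \<open>prim\<close> is used again, now on
      \<open>b \<up> k\<close> and \<open>s \<up> (2 * k)\<close>; its second alternative would put
      a power of \<open>s\<close> into the radical.\<close>
    have "s \<odot> s \<up> (2 * k) = s \<up> Suc (2 * k)" using M.nat_pow_Suc2[of s] sR by simp
    then have "s \<odot> s \<up> (2 * k) \<notin> rad I" using disjoint_rad_pow[OF S I s] by metis
    then have "s \<odot> b \<up> k \<in> I" using prim[OF _ _ bs] ab sR by simp
    then have "b \<up> k \<odot> s \<in> I" using mul_comm[of s "b \<up> k"] ab sR by simp
    then show ?thesis using radI[of b k] ab by (auto simp: colon_eq)
  qed
qed

lemma mul_rad_colon:
  assumes s: "s \<in> R" and b: "b \<in> rad (colon I s)"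
  shows "s \<odot> b \<in> rad I"
  unfolding hyper_radical_def
proof (intro IntI InterI)
  have bR: "b \<in> R" using b by (simp add: hyper_radical_def)
  then show "s \<odot> b \<in> R" using s by simp
  fix P assume "P \<in> {P. is_prime P \<and> I \<subseteq> P}"
  then have P: "is_prime P" "I \<subseteq> P" "is_hyperideal P" by (auto simp: prime_hyperideal_def)
  show "s \<odot> b \<in> P"
  proof (cases "s \<in> P")
    case True
    then show ?thesis using hyperideal_mul(1)[OF P(3)] bR by blast
  next
    case False
    \<comment> \<open>If \<open>x \<odot> s\<close> lies in \<open>I\<close>, it lies in
      \<open>P\<close>, and primality leaves only \<open>x \<in> P\<close>. So \<open>P\<close> is
      one of the primes that define the radical of the colon.\<close>
    then have "colon I s \<subseteq> P" using prime_mulD[OF P(1) _ s] P(2) by (auto simp: colon_eq)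
    then have "b \<in> P" using b P(1) by (auto simp: hyper_radical_def)
    then show ?thesis using hyperideal_mul(2)[OF P(3)] s by blast
  qed
qed

end

theorem theorem4p4:
  fixes R S I :: "'a set" and m n :: nat
    and f :: "'a list \<Rightarrow> 'a set" and g :: "'a list \<Rightarrow> 'a" and e :: 'a
  assumes "krasner_hyperring R m n f g"
    and "scalar_identity R n g e"
    and "multiplicative_subset R n g S"
    and "hyperideal R m n f g I"
    and "I \<inter> S = {}"
  shows "S_primary_hyperideal R m n f g e S I \<longleftrightarrow>
    (\<exists>s\<in>S. primary_hyperideal R m n f g e (hyper_colon R n g e I s))"
proof -
  interpret krasner_hyperring R m n f g by fact
  interpret unital_krasner_hyperring R m n f g e by unfold_locales fact
  have S: "S \<subseteq> R" using assms(3) by (simp add: multiplicative_subset_def)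
  show ?thesis
  proof
    assume "S_primary_hyperideal R m n f g e S I"
    then show "\<exists>s\<in>S. primary_hyperideal R m n f g e (colon I s)"
      using S_primary_imp_colon_primary[OF assms(3-5)] unfolding S_primary_iff[OF S] by metis
  next
    assume "\<exists>s\<in>S. primary_hyperideal R m n f g e (colon I s)"
    then obtain s where s: "s \<in> S" "primary_hyperideal R m n f g e (colon I s)" by blast
    then have sR: "s \<in> R" using S by blast
    have "s \<odot> a \<in> I \<or> s \<odot> b \<in> rad I" if ab: "a \<in> R" "b \<in> R" "a \<odot> b \<in> I" for a b
    proof -
      \<comment> \<open>Since \<open>I\<close> is contained in its colon, the product
        \<open>a \<odot> b\<close> lies there and primariness applies.\<close>
      have "a \<in> colon I s \<or> b \<in> rad (colon I s)"
        using s(2) ab subset_colon[OF assms(4) sR] unfolding primary_iff by blast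
      then show ?thesis using mul_rad_colon[OF sR] mul_comm[OF sR ab(1)] by (auto simp: colon_eq)
    qed
    then show "S_primary_hyperideal R m n f g e S I"
      unfolding S_primary_iff[OF S] using assms(4,5) s(1) by blast
  qed
qed

end
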